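(* Let $n\ge1$, $\Theta\subseteq\mathsf{FORM}_n$ and $\psi\in\mathsf{FORM}_n$. Then for every integer $m\ge n$, $\Theta\models_{(n,\partial)}\psi$ if and only if $\Theta\models_{(m,\partial)}\psi$.
   Context: $\mathsf{FORM}_k$ is the set of formulas of infinite-valued Łukasiewicz propositional logic in the variables $X_1,\dots,X_k$; note $\mathsf{FORM}_n\subseteq\mathsf{FORM}_m$ for $n\le m$. Each $\phi\in\mathsf{FORM}_k$ determines a function $\hat\phi\colon[0,1]^k\to[0,1]$: a point $v\in[0,1]^k$ assigns $v_i$ to $X_i$ and $\hat\phi(v)$ is the truth value computed with $\neg x=1-x$, $x\oplus y=\min(1,x+y)$. Differential valuation in $\mathbb R^k$: for $0\le t\le k$, a tuple $U=(u_0,\dots,u_t)$ of vectors in $\mathbb R^k$ with $u_1,\dots,u_t$ pairwise orthogonal unit vectors, such that for all sufficiently large integers $j$ the simplex $T_{U,j}=\mathrm{conv}(u_0,\,u_0+u_1/j,\dots,u_0+u_1/j+\cdots+u_t/j^t)$ is contained in $[0,1]^k$. $U$ satisfies $\psi\in\mathsf{FORM}_k$ if $\hat\psi=1$ on $T_{U,j}$ for some $j$. For $\Theta\subseteq\mathsf{FORM}_k$, $\psi\in\mathsf{FORM}_k$, $\Theta\models_{(k,\partial)}\psi$ means that every differential valuation in $\mathbb R^k$ satisfying every $\theta\in\Theta$ (viewed as elements of $\mathsf{FORM}_k$) also satisfies $\psi$. *)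

theory Defs
  imports "HOL-Analysis.Analysis" "HOL-Analysis.Finite_Function_Topology"
begin

text \<open>
  \<open>Var i\<close> stands for the variable \<open>X\<^sub>i\<close>, with indices starting at 1. The primitive connectives
  are negation and strong disjunction; the other Lukasiewicz connectives abbreviate
  combinations of these two.
\<close>

datatype form = Var nat | Neg form | Oplus form form

primrec vars :: "form \<Rightarrow> nat set" where
  "vars (Var i) = {i}"
| "vars (Neg \<phi>) = vars \<phi>"
| "vars (Oplus \<phi> \<rho>) = vars \<phi> \<union> vars \<rho>"

definition FORM :: "nat \<Rightarrow> form set" where
  "FORM k = {\<phi>. vars \<phi> \<subseteq> {1..k}}"

text \<open>
  A vector of \<open>\<real>\<^sup>k\<close> is a finitely supported function on the indices that vanishes outside
  \<open>{1..k}\<close>. This keeps the dimension a term, and the type is a real vector space, so the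
  library's convex hull applies.
\<close>

type_synonym vect = "nat \<Rightarrow>\<^sub>0 real"

definition Rn :: "nat \<Rightarrow> vect set" where
  "Rn k = {x. Poly_Mapping.keys x \<subseteq> {1..k}}"

definition dot :: "nat \<Rightarrow> vect \<Rightarrow> vect \<Rightarrow> real" where
  "dot k x y = (\<Sum>i = 1..k. Poly_Mapping.lookup x i * Poly_Mapping.lookup y i)"

definition cube :: "nat \<Rightarrow> vect set" where
  "cube k = {x \<in> Rn k. \<forall>i\<in>{1..k}. 0 \<le> Poly_Mapping.lookup x i \<and> Poly_Mapping.lookup x i \<le> 1}"

text \<open>\<open>hat \<phi>\<close> is meaningful as the truth function of \<open>\<phi> \<in> FORM k\<close> only at points of \<open>cube k\<close>.\<close>

primrec hat :: "form \<Rightarrow> vect \<Rightarrow> real" where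
  "hat (Var i) v = Poly_Mapping.lookup v i"
| "hat (Neg \<phi>) v = 1 - hat \<phi> v"
| "hat (Oplus \<phi> \<rho>) v = min 1 (hat \<phi> v + hat \<rho> v)"

text \<open>A tuple \<open>(u\<^sub>0, \<dots>, u\<^sub>t)\<close> is a list of length \<open>t + 1\<close>.\<close>

definition vertex :: "vect list \<Rightarrow> nat \<Rightarrow> nat \<Rightarrow> vect" where
  "vertex U j i = U ! 0 + (\<Sum>l = 1..i. (1 / real j ^ l) *\<^sub>R (U ! l))"

definition simplexT :: "vect list \<Rightarrow> nat \<Rightarrow> vect set" where
  "simplexT U j = convex hull (vertex U j ` {..<length U})"

definition diff_valuation :: "nat \<Rightarrow> vect list \<Rightarrow> bool" where
  "diff_valuation k U \<longleftrightarrow>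
     (\<exists>t\<le>k. length U = Suc t \<and>
        set U \<subseteq> Rn k \<and>
        (\<forall>a\<in>{1..t}. dot k (U ! a) (U ! a) = 1) \<and>
        (\<forall>a\<in>{1..t}. \<forall>b\<in>{1..t}. a \<noteq> b \<longrightarrow> dot k (U ! a) (U ! b) = 0) \<and>
        (\<forall>\<^sub>F j in sequentially. simplexT U j \<subseteq> cube k))"

text \<open>
  The index \<open>j\<close> must be positive, and the simplex must lie in the domain \<open>cube k\<close> of the truth
  function for the equation to make sense on it.
\<close>

definition satisfies :: "nat \<Rightarrow> vect list \<Rightarrow> form \<Rightarrow> bool" where
  "satisfies k U \<psi> \<longleftrightarrow>
     (\<exists>j\<ge>1. simplexT U j \<subseteq> cube k \<and> (\<forall>x\<in>simplexT U j. hat \<psi> x = 1))"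

definition diff_entails :: "nat \<Rightarrow> form set \<Rightarrow> form \<Rightarrow> bool" where
  "diff_entails k \<Theta> \<psi> \<longleftrightarrow>
     (\<forall>U. diff_valuation k U \<longrightarrow> (\<forall>\<theta>\<in>\<Theta>. satisfies k U \<theta>) \<longrightarrow> satisfies k U \<psi>)"

end

theory Submission
  imports Defs
begin

text \<open>
  Only the germ of the family \<open>T\<^sub>U\<^sub>,\<^sub>j\<close> as \<open>j \<rightarrow> \<infinity>\<close> matters for satisfaction, and two families that
  are cofinal in each other satisfy the same formulas. The truth function of a formula of
  \<open>FORM n\<close> factors through the projection of \<open>\<real>\<^sup>m\<close> onto \<open>\<real>\<^sup>n\<close>. The projected directions
  are no longer orthonormal, but Gram-Schmidt, dropping the vectors that vanish on the way,
  replaces the family of simplices by a mutually cofinal one.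
\<close>

section \<open>Simplices moved to the origin, in nested form\<close>

text \<open>This describes conv(0, w1/j, w1/j + w2/j^2, ...) by coefficients: its points are c1 w1 +
  c2 w2 + ... with 0 <= c1 <= 1/j and each later coefficient between 0 and 1/j times the previous
  one. Factoring the leading coefficient out of the tail permits induction on the list;
  \<open>convex_hull_corner\<close> proves the agreement.\<close>

primrec corner :: "nat \<Rightarrow> 'a::real_vector list \<Rightarrow> 'a set" where
  "corner j [] = {0}"
| "corner j (w # ws) = {a *\<^sub>R w + a *\<^sub>R x | a x. 0 \<le> a \<and> a \<le> 1 / real j \<and> x \<in> corner j ws}"

lemma corner_ConsI:
  assumes "0 \<le> a" "a \<le> 1 / real j" "x \<in> corner j ws" "y = a *\<^sub>R w + a *\<^sub>R x"
  shows "y \<in> corner j (w # ws)"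
  using assms by auto

text \<open>The leading coefficient alone absorbs the scalar, since a <= 1/J gives r a <= r/J <=
  1/j. The factors behind it only pass from \<open>J\<close> to \<open>j\<close>, which is the
  induction hypothesis with scalar 1.\<close>

lemma scaleR_in_corner:
  assumes "x \<in> corner J ws" "0 \<le> r" "r * real j \<le> real J" "1 \<le> j" "j \<le> J"
  shows "r *\<^sub>R x \<in> corner j ws"
  using assms
proof (induction ws arbitrary: x r)
  case Nil
  then show ?case by simp
next
  case (Cons w ws)
  from Cons.prems(1) obtain a y where
    ay: "0 \<le> a" "a \<le> 1 / real J" "y \<in> corner J ws" "x = a *\<^sub>R w + a *\<^sub>R y"
    by auto
  have y: "y \<in> corner j ws"
    using Cons.IH[of y 1] ay(3) Cons.prems by simp
  have "r * a \<le> r * (1 / real J)"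
    using ay Cons.prems by (intro mult_left_mono) auto
  also have "\<dots> \<le> 1 / real j"
    using Cons.prems by (simp add: field_simps)
  finally show ?case
    using ay y Cons.prems by (intro corner_ConsI[of "r * a" j y]) (auto simp: scaleR_add_right)
qed

lemma corner_antimono:
  assumes "1 \<le> j" "j \<le> J"
  shows "corner J ws \<subseteq> corner j ws"
  using scaleR_in_corner[of _ J ws 1 j] assms by auto

lemma corner_linear_image:
  assumes "linear f"
  shows "corner j (map f ws) = f ` corner j ws"
proof (induction ws)
  case Nil
  then show ?case by (simp add: linear_0[OF assms])
next
  case (Cons w ws)
  have "f (a *\<^sub>R w + a *\<^sub>R x) = a *\<^sub>R f w + a *\<^sub>R f x" for a x
    by (simp add: linear_add[OF assms] linear_scale[OF assms])
  then show ?case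
    by (fastforce simp: Cons.IH image_iff)
qed

text \<open>The leading factor contributes 1/j, and what it multiplies is bounded by |f w| + C. In
  \<open>corner_le_shear\<close> this keeps 1 + f y close to 1.\<close>

lemma corner_linear_functional_bound:
  fixes f :: "'a::real_vector \<Rightarrow> real"
  assumes "linear f"
  shows "\<exists>C\<ge>0. \<forall>j\<ge>1. \<forall>x\<in>corner j ws. \<bar>f x\<bar> \<le> C / real j"
proof (induction ws)
  case Nil
  then show ?case by (auto simp: linear_0[OF assms])
next
  case (Cons w ws)
  then obtain C where C: "C \<ge> 0" "\<And>j x. j \<ge> 1 \<Longrightarrow> x \<in> corner j ws \<Longrightarrow> \<bar>f x\<bar> \<le> C / real j"
    by blast
  have "\<bar>f x\<bar> \<le> (\<bar>f w\<bar> + C) / real j" if j: "j \<ge> 1" and x: "x \<in> corner j (w # ws)" for j x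
  proof -
    from x obtain a y where ay: "0 \<le> a" "a \<le> 1 / real j" "y \<in> corner j ws"
      "x = a *\<^sub>R w + a *\<^sub>R y"
      by auto
    have "C / real j \<le> C / 1"
      using C(1) j by (intro divide_left_mono) auto
    then have "\<bar>f y\<bar> \<le> C" using C(2)[OF j ay(3)] by linarith
    then have "\<bar>f w + f y\<bar> \<le> \<bar>f w\<bar> + C" by linarith
    then have "a * \<bar>f w + f y\<bar> \<le> (1 / real j) * (\<bar>f w\<bar> + C)"
      using ay by (intro mult_mono) auto
    moreover have "f x = a * (f w + f y)"
      by (simp add: ay(4) linear_add[OF assms] linear_scale[OF assms] algebra_simps)
    ultimately show ?thesis
      using ay(1) by (simp add: abs_mult)
  qed
  with C(1) show ?case by (intro exI[of _ "\<bar>f w\<bar> + C"]) auto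
qed

section \<open>Cofinality of corner families, and list operations that preserve it\<close>

text \<open>This preorder in both directions is mutual cofinality. \<open>J\<close> must be
  positive: \<open>1 / real 0\<close> is 0, so \<open>corner 0 vs\<close> is the origin alone and
  would make the relation trivial.\<close>

definition corner_le :: "'a::real_vector list \<Rightarrow> 'a list \<Rightarrow> bool" where
  "corner_le vs ws \<longleftrightarrow> (\<forall>j\<ge>1. \<exists>J\<ge>1. corner J vs \<subseteq> corner j ws)"

lemma corner_leD:
  assumes "corner_le vs ws" "1 \<le> j"
  obtains J where "1 \<le> J" "j \<le> J" "corner J vs \<subseteq> corner j ws"
proof -
  obtain J where J: "1 \<le> J" "corner J vs \<subseteq> corner j ws"
    using assms unfolding corner_le_def by blast
  have "corner (max J j) vs \<subseteq> corner J vs"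
    using J by (intro corner_antimono) auto
  with J show ?thesis by (intro that[of "max J j"]) auto
qed

lemma corner_le_refl: "corner_le ws ws"
  unfolding corner_le_def by blast

lemma corner_le_trans:
  assumes "corner_le us vs" "corner_le vs ws"
  shows "corner_le us ws"
  using assms unfolding corner_le_def by (meson order_trans)

lemma corner_le_Cons:
  assumes "corner_le vs ws"
  shows "corner_le (w # vs) (w # ws)"
  unfolding corner_le_def
proof (intro allI impI)
  fix j :: nat assume j: "1 \<le> j"
  obtain J where J: "1 \<le> J" "j \<le> J" "corner J vs \<subseteq> corner j ws"
    using corner_leD[OF assms j] by blast
  have "1 / real J \<le> 1 / real j" using J j by (simp add: field_simps)
  then have "corner J (w # vs) \<subseteq> corner j (w # ws)" using J(3) by fastforce
  with J show "\<exists>J\<ge>1. corner J (w # vs) \<subseteq> corner j (w # ws)" by blast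
qed

lemma corner_le_zero_Cons: "corner_le (0 # ws) ws"
proof -
  have "corner j (0 # ws) \<subseteq> corner j ws" if "j \<ge> 1" for j
  proof
    fix x assume "x \<in> corner j (0 # ws)"
    then obtain a y where ay: "0 \<le> a" "a \<le> 1 / real j" "y \<in> corner j ws" "x = a *\<^sub>R y" by auto
    moreover have "1 / real j \<le> 1" using that by simp
    ultimately have "a * real j \<le> 1 * real j"
      by (intro mult_right_mono) auto
    then show "x \<in> corner j ws"
      unfolding ay(4) using ay(1,3) that by (intro scaleR_in_corner) auto
  qed
  then show ?thesis unfolding corner_le_def by blast
qed

text \<open>A zero direction still multiplies everything behind it by a factor of at most 1/j.
  Writing x as 1/j times j x supplies that factor, and index \<open>j * j\<close> leaves room for
  the compensating scalar j.\<close>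

lemma zero_Cons_corner_le: "corner_le ws (0 # ws)"
proof -
  have "corner (j * j) ws \<subseteq> corner j (0 # ws)" if j: "j \<ge> 1" for j
  proof
    fix x assume "x \<in> corner (j * j) ws"
    then have "real j *\<^sub>R x \<in> corner j ws"
      using j by (intro scaleR_in_corner) auto
    then show "x \<in> corner j (0 # ws)"
      using j by (intro corner_ConsI[of "1 / real j" j "real j *\<^sub>R x"]) auto
  qed
  moreover have "j * j \<ge> 1" if "j \<ge> 1" for j :: nat using that by simp
  ultimately show ?thesis unfolding corner_le_def by blast
qed

text \<open>Rewrite a w + a y as (a/r)(r w) + (a/r)(r y): the coefficient is divided by r and the
  tail is multiplied by r.\<close>

lemma corner_le_scaleR_head:
  fixes r :: real
  assumes "0 < r"
  shows "corner_le (w # ws) (r *\<^sub>R w # ws)"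
  unfolding corner_le_def
proof (intro allI impI)
  fix j :: nat assume j: "1 \<le> j"
  \<comment> \<open>\<open>N\<close> dominates r, so that r y stays in the tail corner, and 1/r, so
    that a/r <= 1/j.\<close>
  obtain N :: nat where N: "real N \<ge> r + 1 / r + 1" using real_arch_simple by blast
  define J where "J = N * j"
  have pos: "1 / r > 0" using assms by simp
  have N1: "N \<ge> 1" using N assms pos by linarith
  have J: "1 \<le> J" "j \<le> J" using N1 j by (auto simp: J_def)
  have Nr: "r \<le> real N" "1 / r \<le> real N" using N assms pos by linarith+
  have "corner J (w # ws) \<subseteq> corner j (r *\<^sub>R w # ws)"
  proof
    fix x assume "x \<in> corner J (w # ws)"
    then obtain a y where ay: "0 \<le> a" "a \<le> 1 / real J" "y \<in> corner J ws"
      "x = a *\<^sub>R w + a *\<^sub>R y"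
      by auto
    have "r *\<^sub>R y \<in> corner j ws"
      using ay(3) assms j J Nr by (intro scaleR_in_corner) (auto simp: J_def mult_right_mono)
    moreover have "a / r \<le> 1 / real j"
    proof -
      have "a * (1 / r) \<le> (1 / real J) * real N"
        using ay Nr pos by (intro mult_mono) auto
      also have "\<dots> = 1 / real j" using N1 by (simp add: J_def)
      finally show ?thesis by simp
    qed
    ultimately show "x \<in> corner j (r *\<^sub>R w # ws)"
      using ay assms by (intro corner_ConsI[of "a / r" j "r *\<^sub>R y"]) auto
  qed
  with J show "\<exists>J\<ge>1. corner J (w # ws) \<subseteq> corner j (r *\<^sub>R w # ws)" by blast
qed

text \<open>With s = 1 + f y, the point a w + a (g y + f y w) equals (a s) w + (a s)(g y / s), so
  the multiple of w hidden in the tail moves into the leading coefficient. A general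
  \<open>g\<close> lets the lemma both remove and restore the component along the head in
  Gram-Schmidt.\<close>

lemma corner_le_shear:
  fixes f :: "'a::real_vector \<Rightarrow> real"
  assumes f: "linear f" and g: "linear g"
  shows "corner_le (w # map (\<lambda>x. g x + f x *\<^sub>R w) ws) (w # map g ws)"
  unfolding corner_le_def
proof (intro allI impI)
  fix j :: nat assume j: "1 \<le> j"
  obtain C where C: "C \<ge> 0" "\<And>j x. j \<ge> 1 \<Longrightarrow> x \<in> corner j ws \<Longrightarrow> \<bar>f x\<bar> \<le> C / real j"
    using corner_linear_functional_bound[OF f] by blast
  \<comment> \<open>The part 2 C forces |f y| <= 1/2, hence s and 1/s are at most 2; the part 2 pays
    for these two factors.\<close>
  obtain N :: nat where N: "real N \<ge> 2 * C + 2" using real_arch_simple by blast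
  define J where "J = N * j"
  have N2: "N \<ge> 2" using N C(1) by linarith
  have J: "1 \<le> J" "2 * j \<le> J" "N \<le> J" using N2 j by (auto simp: J_def)
  have lin: "linear (\<lambda>x. g x + f x *\<^sub>R w)"
    by (rule linearI) (simp_all add: linear_add[OF f] linear_scale[OF f]
        linear_add[OF g] linear_scale[OF g] algebra_simps)
  have "corner J (w # map (\<lambda>x. g x + f x *\<^sub>R w) ws) \<subseteq> corner j (w # map g ws)"
  proof
    fix x assume "x \<in> corner J (w # map (\<lambda>x. g x + f x *\<^sub>R w) ws)"
    then obtain a y where ay: "0 \<le> a" "a \<le> 1 / real J" "y \<in> corner J ws"
      "x = a *\<^sub>R w + a *\<^sub>R (g y + f y *\<^sub>R w)"
      by (auto simp: corner_linear_image[OF lin])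
    have "C / real J \<le> 1 / 2"
      using N J by (simp add: field_simps)
    then have fy: "\<bar>f y\<bar> \<le> 1 / 2" using C(2)[OF J(1) ay(3)] by linarith
    define s where "s = 1 + f y"
    have s: "1 / 2 \<le> s" "s \<le> 2" using fy by (auto simp: s_def)
    have "(1 / s) *\<^sub>R y \<in> corner j ws"
    proof (rule scaleR_in_corner[OF ay(3)])
      have "1 / s \<le> 2" using s by (simp add: field_simps)
      then have "1 / s * real j \<le> 2 * real j" by (intro mult_right_mono) auto
      also have "\<dots> \<le> real J" using J by linarith
      finally show "1 / s * real j \<le> real J" .
    qed (use s j J in auto)
    then have "(1 / s) *\<^sub>R g y \<in> corner j (map g ws)"
      unfolding corner_linear_image[OF g] linear_scale[OF g, symmetric] by (rule imageI)
    moreover have "a * s \<le> 1 / real j"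
    proof -
      have "a * s \<le> (1 / real J) * 2"
        using ay s by (intro mult_mono) auto
      also have "\<dots> \<le> 1 / real j" using J j by (simp add: field_simps)
      finally show ?thesis .
    qed
    moreover have "x = (a * s) *\<^sub>R w + (a * s) *\<^sub>R ((1 / s) *\<^sub>R g y)"
    proof -
      have "(a * s) *\<^sub>R ((1 / s) *\<^sub>R g y) = a *\<^sub>R g y" using s by simp
      then show ?thesis
        by (simp only: ay(4)) (simp add: s_def algebra_simps)
    qed
    ultimately show "x \<in> corner j (w # map g ws)"
      using ay s by (intro corner_ConsI[of "a * s" j "(1 / s) *\<^sub>R g y"]) auto
  qed
  with J show "\<exists>J\<ge>1. corner J (w # map (\<lambda>x. g x + f x *\<^sub>R w) ws) \<subseteq> corner j (w # map g ws)" by blast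
qed

section \<open>Identification of corners with the simplices of a valuation\<close>

text \<open>Apart from 0, the vertices are those of the tail under the affine map sending x to (w +
  x)/j. The hull of 0 and a convex set consists of its multiples by v in [0,1], and v/j is the
  leading coefficient.\<close>

lemma convex_hull_corner:
  "convex hull ((\<lambda>i. \<Sum>l<i. (1 / real j ^ Suc l) *\<^sub>R (ws ! l)) ` {..length ws}) = corner j ws"
proof (induction ws)
  case Nil
  then show ?case by simp
next
  case (Cons w ws)
  let ?p = "\<lambda>ws i. \<Sum>l<i. (1 / real j ^ Suc l) *\<^sub>R (ws ! l)"
  let ?g = "\<lambda>x. (1 / real j) *\<^sub>R w + (1 / real j) *\<^sub>R x"
  have p: "?p (w # ws) (Suc i) = ?g (?p ws i)" for i
    by (simp add: sum.lessThan_Suc_shift scaleR_sum_right del: sum.lessThan_Suc)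
  have "?p (w # ws) ` {..length (w # ws)} = insert 0 (?g ` ?p ws ` {..length ws})"
    unfolding length_Cons atMost_Suc_eq_insert_0 image_insert image_image p by simp
  then have "convex hull (?p (w # ws) ` {..length (w # ws)})
      = convex hull (insert 0 (?g ` ?p ws ` {..length ws}))"
    by simp
  also have "\<dots> = {x. \<exists>u\<ge>0. \<exists>v\<ge>0. \<exists>b. u + v = 1 \<and> b \<in> ?g ` corner j ws \<and> x = u *\<^sub>R 0 + v *\<^sub>R b}"
    by (subst convex_hull_insert) (simp_all only: convex_hull_affinity Cons.IH, simp)
  also have "\<dots> = corner j (w # ws)"
  proof (intro set_eqI iffI)
    fix x
    assume "x \<in> {x. \<exists>u\<ge>0. \<exists>v\<ge>0. \<exists>b. u + v = 1 \<and> b \<in> ?g ` corner j ws \<and> x = u *\<^sub>R 0 + v *\<^sub>R b}"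
    then obtain u v y where uv: "0 \<le> u" "0 \<le> v" "u + v = 1" "y \<in> corner j ws" "x = v *\<^sub>R ?g y"
      by auto
    then have "v / real j \<le> 1 / real j" by (intro divide_right_mono) auto
    with uv show "x \<in> corner j (w # ws)"
      by (intro corner_ConsI[of "v / real j" j y]) (auto simp: scaleR_add_right)
  next
    fix x assume "x \<in> corner j (w # ws)"
    then obtain a y where ay: "0 \<le> a" "a \<le> 1 / real j" "y \<in> corner j ws" "x = a *\<^sub>R w + a *\<^sub>R y"
      by auto
    \<comment> \<open>For \<open>j = 0\<close> the bound \<open>1 / real j\<close> is 0, so a = 0
      and both sides reduce to the origin.\<close>
    have "a * real j \<le> 1" using ay(1,2) by (cases "j = 0") (auto simp: field_simps)
    moreover have "x = (a * real j) *\<^sub>R ?g y"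
      using ay by (cases "j = 0") (auto simp: scaleR_add_right)
    ultimately show "x \<in> {x. \<exists>u\<ge>0. \<exists>v\<ge>0. \<exists>b. u + v = 1 \<and> b \<in> ?g ` corner j ws \<and> x = u *\<^sub>R 0 + v *\<^sub>R b}"
      using ay by (intro CollectI exI[of _ "1 - a * real j"] conjI exI[of _ "a * real j"] exI[of _ "?g y"]) auto
  qed
  finally show ?case .
qed

lemma simplexT_Cons: "simplexT (u # ws) j = (+) u ` corner j ws"
proof -
  have v: "vertex (u # ws) j i = u + (\<Sum>l<i. (1 / real j ^ Suc l) *\<^sub>R (ws ! l))" for i
    unfolding vertex_def by (simp add: sum.atLeast1_atMost_eq)
  have "simplexT (u # ws) j
      = convex hull ((+) u ` (\<lambda>i. \<Sum>l<i. (1 / real j ^ Suc l) *\<^sub>R (ws ! l)) ` {..length ws})"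
    unfolding simplexT_def by (simp add: v image_image lessThan_Suc_atMost)
  then show ?thesis
    by (simp only: convex_hull_translation convex_hull_corner)
qed

lemma simplexT_Cons_antimono:
  assumes "1 \<le> j" "j \<le> J"
  shows "simplexT (u # ws) J \<subseteq> simplexT (u # ws) j"
  unfolding simplexT_Cons using corner_antimono[OF assms] by (intro image_mono)

section \<open>Inner product and Gram-Schmidt\<close>

lemma lookup_scaleR_poly_mapping:
  "Poly_Mapping.lookup (r *\<^sub>R (x :: 'i \<Rightarrow>\<^sub>0 'a::real_vector)) i = r *\<^sub>R Poly_Mapping.lookup x i"
proof -
  have "finite {i. r *\<^sub>R Poly_Mapping.lookup x i \<noteq> 0}"
    by (rule finite_subset[OF _ finite_lookup[of x]]) auto
  then show ?thesis by (simp add: scaleR_poly_mapping_def)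
qed

lemma dot_commute: "dot k x y = dot k y x"
  by (simp add: dot_def mult.commute)

lemma linear_dot: "linear (\<lambda>x. dot k x y)"
  by (rule linearI)
    (simp_all add: dot_def lookup_add lookup_scaleR_poly_mapping sum.distrib sum_distrib_left
      algebra_simps)

lemmas dot_add_left = linear_add[OF linear_dot]
  and dot_scaleR_left = linear_scale[OF linear_dot]
  and dot_zero_left = linear_0[OF linear_dot]
  and dot_diff_left = linear_diff[OF linear_dot]

lemma dot_scaleR_right: "dot k x (r *\<^sub>R y) = r * dot k x y"
  using dot_scaleR_left[of k r y x] by (simp add: dot_commute)

lemma subspace_Rn: "subspace (Rn k)"
proof -
  have "Rn k = {x. \<forall>i. i \<notin> {1..k} \<longrightarrow> Poly_Mapping.lookup x i = 0}"
    by (auto simp: Rn_def in_keys_iff)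
  then show ?thesis
    by (simp add: subspace_def lookup_add lookup_scaleR_poly_mapping)
qed

lemma dot_pos:
  assumes "x \<in> Rn k" "x \<noteq> 0"
  shows "dot k x x > 0"
proof -
  obtain i where i: "Poly_Mapping.lookup x i \<noteq> 0"
    using assms(2) by (metis poly_mapping_eqI lookup_zero)
  with assms(1) have "i \<in> {1..k}" by (auto simp: Rn_def in_keys_iff)
  with i show ?thesis
    unfolding dot_def by (intro sum_pos2[of _ i]) (auto simp: zero_less_mult_iff)
qed

definition orthonormal :: "nat \<Rightarrow> vect list \<Rightarrow> bool" where
  "orthonormal k vs \<longleftrightarrow> (\<forall>v\<in>set vs. dot k v v = 1) \<and> sorted_wrt (\<lambda>v w. dot k v w = 0) vs"

text \<open>The last conjunct keeps the orthonormalised tail orthogonal to the head already chosen.\<close>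

lemma ex_orthonormal_cofinal:
  assumes "set ws \<subseteq> Rn k"
  shows "\<exists>vs. set vs \<subseteq> Rn k \<and> orthonormal k vs \<and> corner_le vs ws \<and> corner_le ws vs \<and>
    (\<forall>z. (\<forall>w\<in>set ws. dot k w z = 0) \<longrightarrow> (\<forall>v\<in>set vs. dot k v z = 0))"
  using assms
\<comment> \<open>The recursive call is on \<open>map P ws'\<close> rather than on the tail itself,
  hence induction on the length.\<close>
proof (induction "length ws" arbitrary: ws)
  case 0
  then show ?case by (intro exI[of _ "[]"]) (auto simp: orthonormal_def corner_le_refl)
next
  case (Suc t)
  then obtain w ws' where ws: "ws = w # ws'" and t: "length ws' = t" by (cases ws) auto
  have Rn: "w \<in> Rn k" "set ws' \<subseteq> Rn k" using Suc.prems ws by auto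
  show ?case
  proof (cases "w = 0")
    case True
    obtain vs where vs: "set vs \<subseteq> Rn k" "orthonormal k vs" "corner_le vs ws'" "corner_le ws' vs"
      "\<And>z. \<forall>w\<in>set ws'. dot k w z = 0 \<Longrightarrow> \<forall>v\<in>set vs. dot k v z = 0"
      using Suc.hyps(1)[of ws'] t Rn by blast
    have "corner_le vs ws" "corner_le ws vs"
      using True vs(3,4) unfolding ws
      by (auto intro: corner_le_trans corner_le_zero_Cons zero_Cons_corner_le)
    with vs show ?thesis by (intro exI[of _ vs]) (auto simp: ws)
  next
    case False
    define r where "r = 1 / sqrt (dot k w w)"
    define e where "e = r *\<^sub>R w"
    have dw: "dot k w w > 0" using dot_pos Rn(1) False by blast
    have r: "r > 0" using dw by (simp add: r_def)
    have ee: "dot k e e = 1"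
      using dw by (simp add: e_def r_def dot_scaleR_left dot_scaleR_right)
    have eR: "e \<in> Rn k" using Rn(1) subspace_Rn by (simp add: e_def subspace_scale)
    define P where "P x = x - dot k x e *\<^sub>R e" for x
    have PR: "set (map P ws') \<subseteq> Rn k"
      using Rn(2) eR subspace_Rn by (auto simp: P_def intro!: subspace_diff subspace_scale)
    have Pe: "dot k (P x) e = 0" for x
      by (simp add: P_def dot_diff_left dot_scaleR_left ee)
    obtain vs where vs: "set vs \<subseteq> Rn k" "orthonormal k vs"
      "corner_le vs (map P ws')" "corner_le (map P ws') vs"
      "\<And>z. \<forall>w\<in>set (map P ws'). dot k w z = 0 \<Longrightarrow> \<forall>v\<in>set vs. dot k v z = 0"
      using Suc.hyps(1)[of "map P ws'"] t PR by (metis length_map)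
    \<comment> \<open>The orthogonality conjunct at z = e: every vector of \<open>map P ws'\<close>
      is orthogonal to e.\<close>
    have ve: "\<forall>v\<in>set vs. dot k v e = 0" using vs(5)[of e] Pe by auto
    have on: "orthonormal k (e # vs)"
      using vs(2) ve ee by (auto simp: orthonormal_def dot_commute)
    have P: "linear P"
      by (rule linearI) (simp_all add: P_def dot_add_left dot_scaleR_left algebra_simps)
    \<comment> \<open>Two shears: first P x = x - <x,e> e, with \<open>g\<close> the identity; then
      x = P x + <x,e> e, with \<open>g\<close> equal to \<open>P\<close>.\<close>
    have "corner_le (e # map P ws') (e # ws')"
      using corner_le_shear[OF linear_compose_neg[OF linear_dot] linear_id, of e k e ws']
      by (simp add: P_def[abs_def])
    moreover have "corner_le (e # ws') (e # map P ws')"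
      using corner_le_shear[OF linear_dot P, of e k e ws'] by (simp add: P_def)
    ultimately have "corner_le (e # vs) (e # ws')" "corner_le (e # ws') (e # vs)"
      using corner_le_Cons[OF vs(3)] corner_le_Cons[OF vs(4)]
      by (blast intro: corner_le_trans)+
    moreover have "corner_le (e # ws') ws" "corner_le ws (e # ws')"
      using corner_le_scaleR_head[of r w ws'] corner_le_scaleR_head[of "1 / r" e ws'] r
      by (simp_all add: ws e_def)
    ultimately have "corner_le (e # vs) ws" "corner_le ws (e # vs)"
      by (blast intro: corner_le_trans)+
    moreover have "\<forall>v\<in>set (e # vs). dot k v z = 0" if z: "\<forall>w\<in>set ws. dot k w z = 0" for z
    proof -
      have ez: "dot k e z = 0" using z by (simp add: ws e_def dot_scaleR_left)
      then have "\<forall>w\<in>set (map P ws'). dot k w z = 0"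
        using z by (simp add: ws P_def dot_diff_left dot_scaleR_left)
      with vs(5) ez show ?thesis by simp
    qed
    ultimately show ?thesis
      using vs(1) eR on by (intro exI[of _ "e # vs"]) auto
  qed
qed

lemma orthonormal_distinct_independent:
  assumes "orthonormal k vs"
  shows "distinct vs \<and> independent (set vs)"
  using assms
proof (induction vs)
  case Nil
  then show ?case by (simp add: independent_empty)
next
  case (Cons v vs)
  have IH: "distinct vs" "independent (set vs)" and vv: "dot k v v = 1"
    and orth: "\<And>x. x \<in> set vs \<Longrightarrow> dot k x v = 0"
    using Cons by (auto simp: orthonormal_def dot_commute)
  have "dot k x v = 0" if "x \<in> span (set vs)" for x
    using that
    by (induction rule: span_induct_alt) (auto simp: dot_zero_left dot_add_left dot_scaleR_left orth)
  then have "v \<notin> span (set vs)" using vv by fastforce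
  moreover from this have "v \<notin> set vs" using span_base by blast
  ultimately show ?case using IH by (simp add: independent_insert)
qed

section \<open>Projection to the first n coordinates\<close>

text \<open>The expansion in unit vectors makes membership in their span immediate for
  \<open>orthonormal_length_le\<close>; \<open>lookup_proj\<close> gives the coordinates.\<close>

definition proj :: "nat \<Rightarrow> vect \<Rightarrow> vect" where
  "proj n x = (\<Sum>i = 1..n. Poly_Mapping.lookup x i *\<^sub>R Poly_Mapping.single i 1)"

lemma lookup_proj:
  "Poly_Mapping.lookup (proj n x) i = (if i \<in> {1..n} then Poly_Mapping.lookup x i else 0)"
  by (simp add: proj_def lookup_sum lookup_scaleR_poly_mapping lookup_single when_def if_distrib
      cong: if_cong)

lemma linear_proj: "linear (proj n)"
  by (rule linearI)
    (auto intro!: poly_mapping_eqI simp: lookup_proj lookup_add lookup_scaleR_poly_mapping)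

lemma proj_in_Rn: "proj n x \<in> Rn n"
  by (auto simp: Rn_def in_keys_iff lookup_proj split: if_splits)

lemma proj_eq_self: "x \<in> Rn n \<Longrightarrow> proj n x = x"
  by (intro poly_mapping_eqI) (auto simp: Rn_def in_keys_iff lookup_proj)

lemma proj_in_cube: "x \<in> cube m \<Longrightarrow> n \<le> m \<Longrightarrow> proj n x \<in> cube n"
  by (auto simp: cube_def proj_in_Rn lookup_proj)

lemma hat_proj: "\<phi> \<in> FORM n \<Longrightarrow> hat \<phi> (proj n x) = hat \<phi> x"
  by (induction \<phi>) (auto simp: FORM_def lookup_proj)

text \<open>Independent vectors in the span of k unit vectors number at most k. This supplies the
  bound \<open>t \<le> k\<close> when a differential valuation is built from an orthonormal
  list.\<close>

lemma orthonormal_length_le: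
  assumes "orthonormal k vs" "set vs \<subseteq> Rn k"
  shows "length vs \<le> k"
proof -
  let ?B = "(\<lambda>i. Poly_Mapping.single i 1 :: vect) ` {1..k}"
  have "set vs \<subseteq> span ?B"
  proof
    fix x assume "x \<in> set vs"
    then have "x = proj k x" using assms(2) by (auto simp: proj_eq_self)
    also have "\<dots> \<in> span ?B"
      unfolding proj_def by (intro span_sum span_scale span_base) auto
    finally show "x \<in> span ?B" .
  qed
  then have "card (set vs) \<le> card ?B"
    using orthonormal_distinct_independent[OF assms(1)]
    by (intro conjunct2[OF independent_span_bound]) auto
  also have "\<dots> \<le> k" using card_image_le[of "{1..k}"] by fastforce
  finally show ?thesis
    using orthonormal_distinct_independent[OF assms(1)] by (simp add: distinct_card)
qed

lemma diff_valuation_Cons: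
  "diff_valuation k (u # vs) \<longleftrightarrow> u \<in> Rn k \<and> set vs \<subseteq> Rn k \<and> orthonormal k vs \<and>
     (\<forall>\<^sub>F j in sequentially. simplexT (u # vs) j \<subseteq> cube k)"
proof -
  have "(\<forall>a\<in>{1..length vs}. dot k ((u # vs) ! a) ((u # vs) ! a) = 1)
    \<longleftrightarrow> (\<forall>v\<in>set vs. dot k v v = 1)"
    unfolding all_set_conv_all_nth image_Suc_lessThan[symmetric] by auto
  moreover have "(\<forall>a\<in>{1..length vs}. \<forall>b\<in>{1..length vs}. a \<noteq> b \<longrightarrow> dot k ((u # vs) ! a) ((u # vs) ! b) = 0)
    \<longleftrightarrow> sorted_wrt (\<lambda>v w. dot k v w = 0) vs" (is "?A \<longleftrightarrow> ?B")
  proof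
    assume A: ?A
    show ?B unfolding sorted_wrt_iff_nth_less
    proof (intro allI impI)
      fix a b assume "a < b" "b < length vs"
      then show "dot k (vs ! a) (vs ! b) = 0"
        using A[rule_format, of "Suc a" "Suc b"] by simp
    qed
  next
    assume B: ?B
    have *: "dot k (vs ! a) (vs ! b) = 0" if "a < length vs" "b < length vs" "a \<noteq> b" for a b
      using B that unfolding sorted_wrt_iff_nth_less by (metis dot_commute nat_neq_iff)
    show ?A
    proof (intro ballI impI)
      \<comment> \<open>The directions occupy positions 1, ..., t of \<open>u # vs\<close> but 0,
        ..., t - 1 of \<open>vs\<close>.\<close>
      fix a b assume "a \<in> {1..length vs}" "b \<in> {1..length vs}" "a \<noteq> b"
      then show "dot k ((u # vs) ! a) ((u # vs) ! b) = 0"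
        using *[of "a - 1" "b - 1"] by (auto simp: nth_Cons')
    qed
  qed
  ultimately show ?thesis
    using orthonormal_length_le[of k vs]
    unfolding diff_valuation_def orthonormal_def length_Cons nat.inject list.set insert_subset
    by blast
qed

lemma simplexT_map_proj: "simplexT (map (proj n) U) j = proj n ` simplexT U j" if "U \<noteq> []"
  using that
  by (cases U) (auto simp: simplexT_Cons corner_linear_image[OF linear_proj] image_image
      linear_add[OF linear_proj])

lemma simplexT_subset_Rn:
  assumes "set U \<subseteq> Rn n" "U \<noteq> []"
  shows "simplexT U j \<subseteq> Rn n"
proof -
  have "map (proj n) U = U" using assms(1) by (auto intro!: map_idI simp: proj_eq_self)
  with simplexT_map_proj[OF assms(2), of n j] show ?thesis
    by (metis image_subset_iff proj_in_Rn)
qed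

section \<open>The two implications between the entailments\<close>

lemma cube_iff_of_Rn:
  assumes "n \<le> m" "x \<in> Rn n"
  shows "x \<in> cube m \<longleftrightarrow> x \<in> cube n"
proof
  show "x \<in> cube n" if "x \<in> cube m"
    using proj_in_cube[OF that assms(1)] by (simp add: proj_eq_self[OF assms(2)])
  show "x \<in> cube m" if x: "x \<in> cube n"
  proof -
    have "x \<in> Rn m" using assms by (fastforce simp: Rn_def)
    moreover have "0 \<le> Poly_Mapping.lookup x i \<and> Poly_Mapping.lookup x i \<le> 1" for i
    proof (cases "i \<in> {1..n}")
      case True
      with x show ?thesis by (auto simp: cube_def)
    next
      case False
      with assms(2) have "Poly_Mapping.lookup x i = 0" by (auto simp: Rn_def in_keys_iff)
      then show ?thesis by simp
    qed
    ultimately show ?thesis by (simp add: cube_def)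
  qed
qed

lemma dot_eq_of_Rn:
  assumes "n \<le> m" "x \<in> Rn n"
  shows "dot m x y = dot n x y"
  unfolding dot_def using assms
  by (intro sum.mono_neutral_right) (auto simp: Rn_def in_keys_iff)

text \<open>\<open>Rn n\<close> is literally a subset of \<open>Rn m\<close>, so the same tuple is a
  differential valuation in the larger space, with the same simplices and the same satisfied
  formulas.\<close>

lemma diff_entails_restrict:
  assumes nm: "n \<le> m" and ent: "diff_entails m \<Theta> \<psi>"
  shows "diff_entails n \<Theta> \<psi>"
  unfolding diff_entails_def
proof (intro allI impI)
  fix U assume U: "diff_valuation n U" and sat: "\<forall>\<theta>\<in>\<Theta>. satisfies n U \<theta>"
  from U obtain u vs where Uv: "U = u # vs" by (cases U) (auto simp: diff_valuation_def)
  have R: "set U \<subseteq> Rn n" using U by (auto simp: diff_valuation_def)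
  have c: "simplexT U j \<subseteq> cube m \<longleftrightarrow> simplexT U j \<subseteq> cube n" for j
    using cube_iff_of_Rn[OF nm] simplexT_subset_Rn[OF R] Uv by blast
  have s: "satisfies m U \<phi> \<longleftrightarrow> satisfies n U \<phi>" for \<phi>
    unfolding satisfies_def c ..
  have "set U \<subseteq> Rn m" using R nm by (fastforce simp: Rn_def)
  moreover have "orthonormal m vs"
  proof -
    have "orthonormal n vs" using U Uv by (simp add: diff_valuation_Cons)
    moreover have "dot m v w = dot n v w" if "v \<in> set vs" for v w
      using R that Uv by (intro dot_eq_of_Rn[OF nm]) auto
    ultimately show ?thesis
      by (auto simp: orthonormal_def intro: sorted_wrt_mono_rel[rotated])
  qed
  ultimately have "diff_valuation m U"
    using U c unfolding Uv diff_valuation_Cons by simp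
  with ent sat s show "satisfies n U \<psi>" unfolding diff_entails_def by blast
qed

text \<open>A valuation \<open>V\<close> in dimension n is built from the projection of
  \<open>U\<close>. Satisfaction of the premises descends to \<open>V\<close> by \<open>VU\<close>,
  and satisfaction of the conclusion returns to \<open>U\<close> by \<open>UV\<close>.\<close>

lemma diff_entails_lift:
  assumes nm: "n \<le> m" and \<Theta>: "\<Theta> \<subseteq> FORM n" and \<psi>: "\<psi> \<in> FORM n" and ent: "diff_entails n \<Theta> \<psi>"
  shows "diff_entails m \<Theta> \<psi>"
  unfolding diff_entails_def
proof (intro allI impI)
  fix U assume U: "diff_valuation m U" and sat: "\<forall>\<theta>\<in>\<Theta>. satisfies m U \<theta>"
  from U obtain u ws where Uw: "U = u # ws" by (cases U) (auto simp: diff_valuation_def)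
  have "set (map (proj n) ws) \<subseteq> Rn n" using proj_in_Rn by auto
  then obtain vs where vs: "set vs \<subseteq> Rn n" "orthonormal n vs"
    "corner_le vs (map (proj n) ws)" "corner_le (map (proj n) ws) vs"
    using ex_orthonormal_cofinal by meson
  define V where "V = proj n u # vs"
  have projU: "proj n ` simplexT U j = (+) (proj n u) ` corner j (map (proj n) ws)" for j
    using simplexT_map_proj[of U n j] by (simp add: Uw simplexT_Cons)
  have VU: "\<exists>J\<ge>1. simplexT V J \<subseteq> proj n ` simplexT U j" if "1 \<le> j" for j
    using vs(3) that unfolding corner_le_def projU V_def simplexT_Cons by (blast intro: image_mono)
  have UV: "\<exists>J\<ge>1. proj n ` simplexT U J \<subseteq> simplexT V j" if "1 \<le> j" for j
    using vs(4) that unfolding corner_le_def projU V_def simplexT_Cons by (blast intro: image_mono)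
  obtain j0 where j0: "1 \<le> j0" "\<And>j. j \<ge> j0 \<Longrightarrow> simplexT U j \<subseteq> cube m"
  proof -
    from U obtain N where "\<And>j. j \<ge> N \<Longrightarrow> simplexT U j \<subseteq> cube m"
      unfolding diff_valuation_def eventually_sequentially by blast
    then show ?thesis by (intro that[of "max 1 N"]) auto
  qed
  have "diff_valuation n V"
  proof -
    \<comment> \<open>One simplex of \<open>V\<close> inside the cube suffices, as the later ones
      are contained in it.\<close>
    obtain J where J: "1 \<le> J" "simplexT V J \<subseteq> proj n ` simplexT U j0" using VU j0(1) by blast
    then have "simplexT V J \<subseteq> cube n" using j0(2)[of j0] proj_in_cube[OF _ nm] by blast
    then have "simplexT V j \<subseteq> cube n" if "j \<ge> J" for j
      using simplexT_Cons_antimono[OF J(1) that] unfolding V_def by blast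
    then show ?thesis
      using vs(1,2) proj_in_Rn unfolding V_def diff_valuation_Cons eventually_sequentially by blast
  qed
  moreover have "satisfies n V \<theta>" if "\<theta> \<in> \<Theta>" for \<theta>
  proof -
    obtain j where j: "j \<ge> 1" "simplexT U j \<subseteq> cube m" "\<forall>x\<in>simplexT U j. hat \<theta> x = 1"
      using sat \<open>\<theta> \<in> \<Theta>\<close> unfolding satisfies_def by blast
    obtain J where J: "1 \<le> J" "simplexT V J \<subseteq> proj n ` simplexT U j" using VU j(1) by blast
    have "\<theta> \<in> FORM n" using \<Theta> that by blast
    then have "\<forall>x\<in>simplexT V J. hat \<theta> x = 1" using J(2) j(3) hat_proj by fastforce
    moreover have "simplexT V J \<subseteq> cube n" using J(2) j(2) proj_in_cube[OF _ nm] by blast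
    ultimately show ?thesis using J(1) unfolding satisfies_def by blast
  qed
  ultimately have "satisfies n V \<psi>" using ent unfolding diff_entails_def by blast
  then obtain j where j: "j \<ge> 1" "\<forall>x\<in>simplexT V j. hat \<psi> x = 1"
    unfolding satisfies_def by blast
  obtain J where J: "1 \<le> J" "proj n ` simplexT U J \<subseteq> simplexT V j" using UV j(1) by blast
  \<comment> \<open>The projection does not see the coordinates beyond n, so the index must also
    reach \<open>j0\<close> for the simplex to lie in \<open>cube m\<close>.\<close>
  have "simplexT U (max j0 J) \<subseteq> simplexT U J"
    unfolding Uw using J(1) by (intro simplexT_Cons_antimono) auto
  then have "\<forall>x\<in>simplexT U (max j0 J). hat \<psi> x = 1"
    using J(2) j(2) hat_proj[OF \<psi>] by (metis image_subset_iff subsetD)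
  then show "satisfies m U \<psi>"
    using j0 unfolding satisfies_def by (intro exI[of _ "max j0 J"]) auto
qed

theorem theorem3p11:
  fixes n :: nat and \<Theta> :: "form set" and \<psi> :: form
  assumes "n \<ge> 1" and "\<Theta> \<subseteq> FORM n" and "\<psi> \<in> FORM n"
  shows "\<forall>m\<ge>n. diff_entails n \<Theta> \<psi> \<longleftrightarrow> diff_entails m \<Theta> \<psi>"
  using assms diff_entails_lift diff_entails_restrict by blast

end
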